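(* Let $p$ be a prime and $m\ge1$ an integer. Let $(a_n^{(m+1)})_{n\in\mathbb{N}}$ be a sequence of nonzero elements of $\mathbb{Q}$ with $a_0^{(m+1)}=1$. Let $s^{(i)}:\mathbb{Q}_p\to\mathbb{Q}$ ($i=1,\dots,m-1$) and $s_n^{(m)}:\mathbb{Q}_p\to\mathbb{Q}$ ($n\in\mathbb{N}$) be functions such that $s^{(i)}(0)=s_n^{(m)}(0)=0$ and, for every $\gamma\in\mathbb{Q}_p^*$, $$|\gamma-s^{(i)}(\gamma)|<\min\{|\gamma|,1\}\ (i=1,\dots,m-1),\qquad |\gamma-s_n^{(m)}(\gamma)|<\min\{|\gamma|,1\},\qquad |\gamma-s_n^{(m)}(\gamma)|\le |a_{n+1}^{(m+1)}|$$ for all $n\in\mathbb{N}$, where $|\cdot|$ is the $p$-adic absolute value. Given $\alpha_0^{(1)},\dots,\alpha_0^{(m)}\in\mathbb{Q}_p$, define recursively for $n=0,1,2,\dots$ $$a_n^{(i)}=s^{(i)}(\alpha_n^{(i)})\ (i=1,\dots,m-1),\quad a_n^{(m)}=s_n^{(m)}(\alpha_n^{(m)}),$$ $$\alpha_{n+1}^{(1)}=\frac{a_{n+1}^{(m+1)}}{\alpha_n^{(m)}-a_n^{(m)}},\qquad \alpha_{n+1}^{(i)}=a_{n+1}^{(m+1)}\frac{\alpha_n^{(i-1)}-a_n^{(i-1)}}{\alpha_n^{(m)}-a_n^{(m)}}\ (i=2,\dots,m),$$ and assume this recursion can be carried out for every $n$ (i.e. $\alpha_n^{(m)}\ne a_n^{(m)}$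 for all $n\ge 0$). Let $A_{-j}^{(i)}=\delta_{ij}$ ($j=1,\dots,m$, $i=1,\dots,m+1$), $A_0^{(i)}=a_0^{(i)}$, $A_n^{(i)}=\sum_{j=1}^{m+1}a_n^{(j)}A_{n-j}^{(i)}$ for $n\ge 1$, and $Q_n^{(i)}=A_n^{(i)}/A_n^{(m+1)}$. Then the multidimensional continued fraction with partial quotients $a_n^{(i)}$ converges to $(\alpha_0^{(1)},\dots,\alpha_0^{(m)})$, i.e. $\lim_{n\to\infty}Q_n^{(i)}=\alpha_0^{(i)}$ in $\mathbb{Q}_p$ for each $i=1,\dots,m$.
   Context: $\delta_{ij}$ is the Kronecker delta. The $a_n^{(i)}$ are called partial quotients, the $\alpha_n^{(i)}$ complete quotients, and $Q_n^{(i)}$ the $n$-th convergents of the multidimensional continued fraction. *)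

theory Defs
  imports Complex_Main "Berlekamp_Zassenhaus.Finite_Field"
begin

section \<open>The p-adic absolute value on the rationals\<close>

definition rat_padic_abs :: "nat \<Rightarrow> rat \<Rightarrow> real" where
  "rat_padic_abs p x =
     (if x = 0 then 0
      else real p powi (int (multiplicity (int p) (snd (quotient_of x)))
                        - int (multiplicity (int p) (fst (quotient_of x)))))"

lemma rat_padic_abs_0 [simp]: "rat_padic_abs p 0 = 0"
  by (simp add: rat_padic_abs_def)

context
  fixes p :: nat
  assumes p: "prime p"
begin

lemma rat_padic_abs_fract:
  assumes "a \<noteq> 0" "b \<noteq> 0"
  shows "rat_padic_abs p (of_int a / of_int b) =
           real p powi (int (multiplicity (int p) b) - int (multiplicity (int p) a))"
proof -
  define x where "x = (of_int a / of_int b :: rat)"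
  obtain n d where nd: "quotient_of x = (n, d)"
    by fastforce
  then have d: "d > 0" and x: "x = of_int n / of_int d"
    by (auto intro: quotient_of_denom_pos quotient_of_div)
  have "x \<noteq> 0" using assms by (simp add: x_def)
  with x have n: "n \<noteq> 0" by auto
  have "(of_int (a * d) :: rat) = of_int (b * n)"
    using x d assms by (simp add: x_def field_simps)
  then have "a * d = b * n"
    by (simp only: of_int_eq_iff)
  moreover have "prime_elem (int p)" using p by simp
  ultimately have "multiplicity (int p) a + multiplicity (int p) d
      = multiplicity (int p) b + multiplicity (int p) n"
    using assms d n prime_elem_multiplicity_mult_distrib [of "int p"]
    by (metis less_irrefl)
  then have "int (multiplicity (int p) d) - int (multiplicity (int p) n)
      = int (multiplicity (int p) b) - int (multiplicity (int p) a)"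
    by linarith
  with \<open>x \<noteq> 0\<close> show ?thesis
    by (simp add: rat_padic_abs_def nd flip: x_def)
qed

lemma rat_padic_abs_pos: "x \<noteq> 0 \<Longrightarrow> rat_padic_abs p x > 0"
  using p by (simp add: rat_padic_abs_def prime_gt_0_nat)

lemma rat_padic_abs_ge_0 [simp]: "rat_padic_abs p x \<ge> 0"
  using rat_padic_abs_pos [of x] by (cases "x = 0") auto

lemma rat_padic_abs_eq_0 [simp]: "rat_padic_abs p x = 0 \<longleftrightarrow> x = 0"
  using rat_padic_abs_pos [of x] by (cases "x = 0") auto

lemma rat_padic_abs_1 [simp]: "rat_padic_abs p 1 = 1"
  using rat_padic_abs_fract [of 1 1] by simp

lemma rat_as_fract:
  obtains a b :: int where "b \<noteq> 0" "x = (of_int a / of_int b :: rat)"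
  by (metis quotient_of_div quotient_of_denom_pos less_irrefl surj_pair)

lemma rat_padic_abs_mult: "rat_padic_abs p (x * y) = rat_padic_abs p x * rat_padic_abs p y"
proof (cases "x = 0 \<or> y = 0")
  case False
  obtain a b where ab: "b \<noteq> 0" "x = of_int a / of_int b" by (rule rat_as_fract)
  obtain c d where cd: "d \<noteq> 0" "y = of_int c / of_int d" by (rule rat_as_fract)
  from False ab cd have nz: "a \<noteq> 0" "c \<noteq> 0" by auto
  have pe: "prime_elem (int p)" using p by simp
  have xy: "x * y = of_int (a * c) / of_int (b * d)"
    by (simp add: ab cd)
  have p0: "real p \<noteq> 0" using p by (auto simp: prime_gt_0_nat)
  have "rat_padic_abs p (x * y)
      = real p powi (int (multiplicity (int p) (b * d)) - int (multiplicity (int p) (a * c)))"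
    unfolding xy using nz ab(1) cd(1) by (intro rat_padic_abs_fract) auto
  also have "\<dots> = real p powi ((int (multiplicity (int p) b) - int (multiplicity (int p) a))
      + (int (multiplicity (int p) d) - int (multiplicity (int p) c)))"
    using nz ab(1) cd(1) by (simp add: prime_elem_multiplicity_mult_distrib [OF pe] algebra_simps)
  also have "\<dots> = rat_padic_abs p x * rat_padic_abs p y"
    using nz ab cd p0 by (simp add: power_int_add rat_padic_abs_fract)
  finally show ?thesis .
qed auto

lemma rat_padic_abs_minus [simp]: "rat_padic_abs p (- x) = rat_padic_abs p x"
proof -
  have "rat_padic_abs p (- 1) * rat_padic_abs p (- 1) = 1"
    by (simp flip: rat_padic_abs_mult)
  then have "rat_padic_abs p (- 1) = 1"
    using rat_padic_abs_ge_0 [of "- 1"] by (auto simp: square_eq_1_iff)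
  then show ?thesis
    using rat_padic_abs_mult [of "- 1" x] by simp
qed

lemma rat_padic_abs_diff_commute: "rat_padic_abs p (x - y) = rat_padic_abs p (y - x)"
  using rat_padic_abs_minus [of "x - y"] by simp

lemma rat_padic_abs_inverse: "rat_padic_abs p (inverse x) = inverse (rat_padic_abs p x)"
proof (cases "x = 0")
  case False
  then have "rat_padic_abs p x * rat_padic_abs p (inverse x) = 1"
    by (simp flip: rat_padic_abs_mult)
  then show ?thesis by (metis inverse_unique)
qed auto

lemma rat_padic_abs_ultra:
  "rat_padic_abs p (x + y) \<le> max (rat_padic_abs p x) (rat_padic_abs p y)"
proof (cases "x = 0 \<or> y = 0 \<or> x + y = 0")
  case False
  obtain a b where ab: "b \<noteq> 0" "x = of_int a / of_int b" by (rule rat_as_fract)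
  obtain c d where cd: "d \<noteq> 0" "y = of_int c / of_int d" by (rule rat_as_fract)
  define e f g where "e = a * d" "f = c * b" "g = b * d"
  have g: "g \<noteq> 0" using ab cd by (simp add: e_f_g_def)
  have x: "x = of_int e / of_int g" and y: "y = of_int f / of_int g"
    using ab cd by (simp_all add: e_f_g_def)
  have xy: "x + y = of_int (e + f) / of_int g"
    by (simp add: x y add_divide_distrib)
  have nz: "e \<noteq> 0" "f \<noteq> 0" "e + f \<noteq> 0"
    using False x y xy by auto
  let ?m = "multiplicity (int p)"
  define k where "k = min (?m e) (?m f)"
  have "int p ^ k dvd e" "int p ^ k dvd f"
    unfolding k_def by (auto intro: multiplicity_dvd')
  then have "int p ^ k dvd e + f" by simp
  moreover have "\<not> is_unit (int p)" using p by (auto simp: prime_gt_1_nat)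
  ultimately have k: "k \<le> ?m (e + f)"
    using nz by (intro multiplicity_geI) auto
  have p1: "1 \<le> real p" using p prime_gt_0_nat [of p] by linarith
  have "real p powi (int (?m g) - int (?m (e + f))) \<le> real p powi (int (?m g) - int k)"
    using k p1 by (intro power_int_increasing) auto
  then show ?thesis
    unfolding x y xy [unfolded x y]
    using nz g unfolding rat_padic_abs_fract [OF nz(1) g]
      rat_padic_abs_fract [OF nz(2) g] rat_padic_abs_fract [OF nz(3) g]
    by (auto simp: k_def min_def split: if_splits)
qed (auto simp: le_max_iff_disj)

lemma rat_padic_abs_triangle:
  "rat_padic_abs p (x + y) \<le> rat_padic_abs p x + rat_padic_abs p y"
  by (smt (verit) rat_padic_abs_ge_0 rat_padic_abs_ultra)

lemma rat_padic_abs_abs_diff: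
  "\<bar>rat_padic_abs p x - rat_padic_abs p y\<bar> \<le> rat_padic_abs p (x - y)"
  using rat_padic_abs_triangle [of "x - y" y] rat_padic_abs_triangle [of "y - x" x]
    rat_padic_abs_diff_commute [of x y]
  by simp

end


section \<open>Cauchy sequences of rationals for the p-adic absolute value\<close>

definition padic_cauchy :: "nat \<Rightarrow> (nat \<Rightarrow> rat) \<Rightarrow> bool" where
  "padic_cauchy p X \<longleftrightarrow> (\<forall>e>0. \<exists>N. \<forall>m\<ge>N. \<forall>n\<ge>N. rat_padic_abs p (X m - X n) < e)"

definition padic_null :: "nat \<Rightarrow> (nat \<Rightarrow> rat) \<Rightarrow> bool" where
  "padic_null p X \<longleftrightarrow> (\<lambda>n. rat_padic_abs p (X n)) \<longlonglongrightarrow> 0"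

definition padic_rel :: "nat \<Rightarrow> (nat \<Rightarrow> rat) \<Rightarrow> (nat \<Rightarrow> rat) \<Rightarrow> bool" where
  "padic_rel p X Y \<longleftrightarrow> padic_cauchy p X \<and> padic_cauchy p Y \<and> padic_null p (\<lambda>n. X n - Y n)"

lemma padic_cauchy_const [simp]: "padic_cauchy p (\<lambda>n. c)"
  by (simp add: padic_cauchy_def)

lemma padic_null_0 [simp]: "padic_null p (\<lambda>n. 0)"
  by (simp add: padic_null_def)

context
  fixes p :: nat
  assumes p: "prime p"
begin

lemma padic_cauchy_add:
  assumes "padic_cauchy p X" "padic_cauchy p Y"
  shows "padic_cauchy p (\<lambda>n. X n + Y n)"
  unfolding padic_cauchy_def
proof (intro allI impI)
  fix e :: real
  assume e: "e > 0"
  from e assms(1) obtain M where M: "\<forall>m\<ge>M. \<forall>n\<ge>M. rat_padic_abs p (X m - X n) < e"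
    unfolding padic_cauchy_def by blast
  from e assms(2) obtain N where N: "\<forall>m\<ge>N. \<forall>n\<ge>N. rat_padic_abs p (Y m - Y n) < e"
    unfolding padic_cauchy_def by blast
  have "rat_padic_abs p (X m + Y m - (X n + Y n)) < e"
    if "m \<ge> max M N" "n \<ge> max M N" for m n
    using rat_padic_abs_ultra [OF p, of "X m - X n" "Y m - Y n"] M N that
    by (fastforce simp: add_diff_add)
  then show "\<exists>N. \<forall>m\<ge>N. \<forall>n\<ge>N. rat_padic_abs p (X m + Y m - (X n + Y n)) < e"
    by blast
qed

lemma padic_cauchy_minus: "padic_cauchy p X \<Longrightarrow> padic_cauchy p (\<lambda>n. - X n)"
  unfolding padic_cauchy_def using rat_padic_abs_diff_commute [OF p] by simp

lemma padic_cauchy_diff: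
  "padic_cauchy p X \<Longrightarrow> padic_cauchy p Y \<Longrightarrow> padic_cauchy p (\<lambda>n. X n - Y n)"
  using padic_cauchy_add [of X "\<lambda>n. - Y n"] padic_cauchy_minus [of Y] by simp

lemma padic_cauchy_convergent:
  assumes "padic_cauchy p X"
  shows "convergent (\<lambda>n. rat_padic_abs p (X n))"
proof -
  have "Cauchy (\<lambda>n. rat_padic_abs p (X n))"
    unfolding Cauchy_def
  proof (intro allI impI)
    fix e :: real
    assume "e > 0"
    with assms obtain N where "\<forall>m\<ge>N. \<forall>n\<ge>N. rat_padic_abs p (X m - X n) < e"
      unfolding padic_cauchy_def by blast
    then show "\<exists>N. \<forall>m\<ge>N. \<forall>n\<ge>N. dist (rat_padic_abs p (X m)) (rat_padic_abs p (X n)) < e"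
      unfolding dist_real_def using rat_padic_abs_abs_diff [OF p] by (meson order.strict_trans1)
  qed
  then show ?thesis by (rule real_Cauchy_convergent)
qed

lemma padic_cauchy_bounded:
  assumes "padic_cauchy p X"
  obtains B where "B > 0" "\<And>n. rat_padic_abs p (X n) \<le> B"
proof -
  have "Bseq (\<lambda>n. rat_padic_abs p (X n))"
    using padic_cauchy_convergent [OF assms] by (rule convergent_imp_Bseq)
  then obtain K where "K > 0" "\<forall>n. norm (rat_padic_abs p (X n)) \<le> K"
    by (rule BseqE)
  then show ?thesis by (intro that [of K]) (auto intro: order.trans [OF abs_ge_self])
qed

lemma padic_null_add:
  assumes "padic_null p X" "padic_null p Y"
  shows "padic_null p (\<lambda>n. X n + Y n)"
  unfolding padic_null_def
  by (rule tendsto_sandwich [OF _ _ tendsto_const tendsto_add_zero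
        [OF assms [unfolded padic_null_def]]])
     (auto simp: p rat_padic_abs_triangle intro!: always_eventually)

lemma padic_null_minus_iff [simp]: "padic_null p (\<lambda>n. - X n) \<longleftrightarrow> padic_null p X"
  by (simp add: padic_null_def p)

lemma padic_null_mult_bounded:
  assumes "padic_cauchy p X" "padic_null p Y"
  shows "padic_null p (\<lambda>n. X n * Y n)"
proof -
  obtain B where B: "\<And>n. rat_padic_abs p (X n) \<le> B"
    using padic_cauchy_bounded [OF assms(1)] by blast
  have lim: "(\<lambda>n. B * rat_padic_abs p (Y n)) \<longlonglongrightarrow> 0"
    using assms(2) unfolding padic_null_def by (rule tendsto_mult_right_zero)
  show ?thesis
    unfolding padic_null_def
    by (rule tendsto_sandwich [OF _ _ tendsto_const lim])
       (auto simp: p rat_padic_abs_mult B intro!: always_eventually mult_right_mono)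
qed

lemma padic_cauchy_mult:
  assumes X: "padic_cauchy p X" and Y: "padic_cauchy p Y"
  shows "padic_cauchy p (\<lambda>n. X n * Y n)"
  unfolding padic_cauchy_def
proof (intro allI impI)
  fix e :: real
  assume e: "e > 0"
  obtain A where A: "A > 0" "\<And>n. rat_padic_abs p (X n) \<le> A"
    using padic_cauchy_bounded [OF X] by blast
  obtain B where B: "B > 0" "\<And>n. rat_padic_abs p (Y n) \<le> B"
    using padic_cauchy_bounded [OF Y] by blast
  have "e / B > 0" "e / A > 0" using e A B by auto
  obtain M where M: "\<forall>m\<ge>M. \<forall>n\<ge>M. rat_padic_abs p (X m - X n) < e / B"
    using X \<open>e / B > 0\<close> unfolding padic_cauchy_def by blast
  obtain N where N: "\<forall>m\<ge>N. \<forall>n\<ge>N. rat_padic_abs p (Y m - Y n) < e / A"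
    using Y \<open>e / A > 0\<close> unfolding padic_cauchy_def by blast
  have "rat_padic_abs p (X m * Y m - X n * Y n) < e"
    if "m \<ge> max M N" "n \<ge> max M N" for m n
  proof -
    have "rat_padic_abs p (X m * (Y m - Y n)) \<le> A * rat_padic_abs p (Y m - Y n)"
      by (simp add: p rat_padic_abs_mult A mult_right_mono)
    also have "\<dots> < e"
      using N that A by (auto simp: field_simps)
    finally have 1: "rat_padic_abs p (X m * (Y m - Y n)) < e" .
    have "rat_padic_abs p (Y n * (X m - X n)) \<le> B * rat_padic_abs p (X m - X n)"
      by (simp add: p rat_padic_abs_mult B mult_right_mono)
    also have "\<dots> < e"
      using M that B by (auto simp: field_simps)
    finally have 2: "rat_padic_abs p (Y n * (X m - X n)) < e" .
    have "X m * Y m - X n * Y n = X m * (Y m - Y n) + Y n * (X m - X n)"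
      by (simp add: algebra_simps)
    with 1 2 rat_padic_abs_ultra [OF p, of "X m * (Y m - Y n)" "Y n * (X m - X n)"]
    show ?thesis by simp
  qed
  then show "\<exists>N. \<forall>m\<ge>N. \<forall>n\<ge>N. rat_padic_abs p (X m * Y m - X n * Y n) < e"
    by blast
qed

lemma padic_cauchy_not_null:
  assumes "padic_cauchy p X" "\<not> padic_null p X"
  obtains b N where "b > 0" "\<And>n. n \<ge> N \<Longrightarrow> rat_padic_abs p (X n) > b"
proof -
  obtain L where L: "(\<lambda>n. rat_padic_abs p (X n)) \<longlonglongrightarrow> L"
    using padic_cauchy_convergent [OF assms(1)] by (auto simp: convergent_def)
  have "L \<ge> 0" using L by (rule LIMSEQ_le_const) (simp add: p)
  moreover have "L \<noteq> 0" using L assms(2) by (auto simp: padic_null_def)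
  ultimately have "L > 0" by simp
  then have "\<forall>\<^sub>F n in sequentially. rat_padic_abs p (X n) > L / 2"
    using L by (intro order_tendstoD) auto
  then obtain N where "\<And>n. n \<ge> N \<Longrightarrow> rat_padic_abs p (X n) > L / 2"
    by (auto simp: eventually_sequentially)
  with \<open>L > 0\<close> show ?thesis by (intro that [of "L / 2"]) auto
qed

lemma padic_cauchy_inverse:
  assumes X: "padic_cauchy p X" "\<not> padic_null p X"
  shows "padic_cauchy p (\<lambda>n. inverse (X n))"
  unfolding padic_cauchy_def
proof (intro allI impI)
  fix e :: real
  assume e: "e > 0"
  obtain b N where b: "b > 0" "\<And>n. n \<ge> N \<Longrightarrow> rat_padic_abs p (X n) > b"
    using padic_cauchy_not_null [OF X] by blast
  have "e * (b * b) > 0" using e b by simp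
  then obtain M where M: "\<forall>m\<ge>M. \<forall>n\<ge>M. rat_padic_abs p (X m - X n) < e * (b * b)"
    using X unfolding padic_cauchy_def by blast
  have "rat_padic_abs p (inverse (X m) - inverse (X n)) < e"
    if "m \<ge> max M N" "n \<ge> max M N" for m n
  proof -
    have bm: "rat_padic_abs p (X m) > b" and bn: "rat_padic_abs p (X n) > b"
      using b that by auto
    with b have nz: "X m \<noteq> 0" "X n \<noteq> 0" by auto
    have "inverse (X m) - inverse (X n) = (X n - X m) * inverse (X m * X n)"
      using nz by (simp add: field_simps)
    then have "rat_padic_abs p (inverse (X m) - inverse (X n))
        = rat_padic_abs p (X n - X m) / (rat_padic_abs p (X m) * rat_padic_abs p (X n))"
      by (simp add: p rat_padic_abs_mult rat_padic_abs_inverse divide_inverse)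
    also have "\<dots> \<le> rat_padic_abs p (X n - X m) / (b * b)"
      using b bm bn by (intro divide_left_mono mult_mono mult_pos_pos) (auto simp: p)
    also have "\<dots> < e"
      using M that b by (auto simp: field_simps)
    finally show ?thesis .
  qed
  then show "\<exists>N. \<forall>m\<ge>N. \<forall>n\<ge>N. rat_padic_abs p (inverse (X m) - inverse (X n)) < e"
    by blast
qed

lemma padic_null_inverse_mult:
  assumes "padic_cauchy p X" "\<not> padic_null p X"
  shows "padic_null p (\<lambda>n. inverse (X n) * X n - 1)"
proof -
  obtain b N where b: "b > 0" "\<And>n. n \<ge> N \<Longrightarrow> rat_padic_abs p (X n) > b"
    using padic_cauchy_not_null [OF assms] by blast
  then have "\<And>n. n \<ge> N \<Longrightarrow> X n \<noteq> 0" by fastforce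
  then have "\<forall>\<^sub>F n in sequentially. rat_padic_abs p (inverse (X n) * X n - 1) = 0"
    unfolding eventually_sequentially by (intro exI [of _ N]) (simp add: p)
  then show ?thesis unfolding padic_null_def by (rule tendsto_eventually)
qed

lemma padic_rel_sym: "padic_rel p X Y \<Longrightarrow> padic_rel p Y X"
  using padic_null_minus_iff [of "\<lambda>n. X n - Y n"] by (simp add: padic_rel_def)

lemma padic_rel_trans: "padic_rel p X Y \<Longrightarrow> padic_rel p Y Z \<Longrightarrow> padic_rel p X Z"
  using padic_null_add [of "\<lambda>n. X n - Y n" "\<lambda>n. Y n - Z n"] by (simp add: padic_rel_def)

lemma padic_rel_null_iff:
  assumes "padic_rel p X Y"
  shows "padic_null p X \<longleftrightarrow> padic_null p Y"
  using padic_null_add [of "\<lambda>n. X n - Y n" Y] padic_null_add [of "\<lambda>n. Y n - X n" X]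
    assms padic_rel_sym [OF assms]
  by (auto simp: padic_rel_def)

lemma padic_rel_add:
  assumes "padic_rel p X X'" "padic_rel p Y Y'"
  shows "padic_rel p (\<lambda>n. X n + Y n) (\<lambda>n. X' n + Y' n)"
  using assms padic_null_add [of "\<lambda>n. X n - X' n" "\<lambda>n. Y n - Y' n"]
  by (auto simp: padic_rel_def padic_cauchy_add add_diff_add)

lemma padic_rel_minus:
  assumes "padic_rel p X X'"
  shows "padic_rel p (\<lambda>n. - X n) (\<lambda>n. - X' n)"
  using padic_rel_sym [OF assms] by (auto simp: padic_rel_def padic_cauchy_minus)

lemma padic_rel_mult:
  assumes "padic_rel p X X'" "padic_rel p Y Y'"
  shows "padic_rel p (\<lambda>n. X n * Y n) (\<lambda>n. X' n * Y' n)"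
proof -
  have "padic_null p (\<lambda>n. X n * (Y n - Y' n) + Y' n * (X n - X' n))"
    using assms by (intro padic_null_add padic_null_mult_bounded) (auto simp: padic_rel_def)
  then have "padic_null p (\<lambda>n. X n * Y n - X' n * Y' n)"
    by (simp add: algebra_simps)
  with assms show ?thesis by (auto simp: padic_rel_def padic_cauchy_mult)
qed

lemma padic_rel_inverse:
  assumes "padic_rel p X Y" "\<not> padic_null p X"
  shows "padic_rel p (\<lambda>n. inverse (X n)) (\<lambda>n. inverse (Y n))"
proof -
  have X: "padic_cauchy p X" and Y: "padic_cauchy p Y" and XY: "padic_null p (\<lambda>n. Y n - X n)"
    using assms padic_rel_sym [OF assms(1)] by (auto simp: padic_rel_def)
  have nY: "\<not> padic_null p Y" using assms padic_rel_null_iff by blast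
  let ?iX = "\<lambda>n. inverse (X n)" and ?iY = "\<lambda>n. inverse (Y n)"
  have iX: "padic_cauchy p ?iX" and iY: "padic_cauchy p ?iY"
    using X Y assms(2) nY padic_cauchy_inverse by auto
  obtain b N where b: "b > 0" "\<And>n. n \<ge> N \<Longrightarrow> rat_padic_abs p (X n) > b"
    using padic_cauchy_not_null [OF X assms(2)] by blast
  obtain c M where c: "c > 0" "\<And>n. n \<ge> M \<Longrightarrow> rat_padic_abs p (Y n) > c"
    using padic_cauchy_not_null [OF Y nY] by blast
  have "padic_null p (\<lambda>n. (?iX n * ?iY n) * (Y n - X n))"
    using padic_null_mult_bounded [OF padic_cauchy_mult [OF iX iY] XY] .
  moreover have "\<forall>\<^sub>F n in sequentially.
      rat_padic_abs p ((?iX n * ?iY n) * (Y n - X n)) = rat_padic_abs p (?iX n - ?iY n)"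
    unfolding eventually_sequentially
  proof (intro exI [of _ "max M N"] allI impI)
    fix n assume "n \<ge> max M N"
    then have "rat_padic_abs p (X n) > b" "rat_padic_abs p (Y n) > c"
      using b c by auto
    with b c have "X n \<noteq> 0" "Y n \<noteq> 0" by auto
    then have "(?iX n * ?iY n) * (Y n - X n) = ?iX n - ?iY n"
      by (simp add: field_simps)
    then show "rat_padic_abs p ((?iX n * ?iY n) * (Y n - X n)) = rat_padic_abs p (?iX n - ?iY n)"
      by simp
  qed
  ultimately have "padic_null p (\<lambda>n. ?iX n - ?iY n)"
    unfolding padic_null_def by (blast intro: Lim_transform_eventually)
  with iX iY show ?thesis by (simp add: padic_rel_def)
qed

lemma padic_rel_lim:
  assumes "padic_rel p X Y"
  shows "lim (\<lambda>n. rat_padic_abs p (X n)) = lim (\<lambda>n. rat_padic_abs p (Y n))"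
proof -
  have lim: "(\<lambda>n. rat_padic_abs p (X n - Y n)) \<longlonglongrightarrow> 0"
    using assms by (simp add: padic_rel_def padic_null_def)
  have "\<bar>rat_padic_abs p (Y n) - rat_padic_abs p (X n)\<bar> \<le> rat_padic_abs p (X n - Y n)" for n
    using rat_padic_abs_abs_diff [OF p, of "X n" "Y n"] by linarith
  then have "(\<lambda>n. \<bar>rat_padic_abs p (Y n) - rat_padic_abs p (X n)\<bar>) \<longlonglongrightarrow> 0"
    by (intro tendsto_sandwich [OF _ _ tendsto_const lim] always_eventually) auto
  then have *: "(\<lambda>n. rat_padic_abs p (Y n) - rat_padic_abs p (X n)) \<longlonglongrightarrow> 0"
    by (rule tendsto_rabs_zero_cancel)
  have "convergent (\<lambda>n. rat_padic_abs p (X n))"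
    using assms by (simp add: padic_rel_def padic_cauchy_convergent)
  then obtain L where L: "(\<lambda>n. rat_padic_abs p (X n)) \<longlonglongrightarrow> L"
    by (auto simp: convergent_def)
  from tendsto_add [OF * L] have "(\<lambda>n. rat_padic_abs p (Y n)) \<longlonglongrightarrow> L" by simp
  with L show ?thesis by (simp add: limI)
qed

end


section \<open>The field of p-adic numbers\<close>

text \<open>
  The p-adic numbers are the completion of the rationals, that is, Cauchy sequences modulo null
  sequences.  The prime is the cardinality of the index type, as for the type of residues modulo
  a prime in \<^theory>\<open>Berlekamp_Zassenhaus.Finite_Field\<close>.
\<close>

typedef (overloaded) 'p padic_seq = "{X. padic_cauchy CARD('p::prime_card) X}"
  morphisms seq_of Abs_padic_seq
  by (rule exI [of _ "\<lambda>n. 0"]) simp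

setup_lifting type_definition_padic_seq

lift_definition padic_seq_rel :: "'p::prime_card padic_seq \<Rightarrow> 'p padic_seq \<Rightarrow> bool"
  is "padic_rel CARD('p)" .

lift_definition seq_const :: "rat \<Rightarrow> 'p::prime_card padic_seq" is "\<lambda>q n. q"
  by simp

lift_definition seq_add :: "'p::prime_card padic_seq \<Rightarrow> 'p padic_seq \<Rightarrow> 'p padic_seq"
  is "\<lambda>X Y n. X n + Y n"
  by (rule padic_cauchy_add [OF prime_card])

lift_definition seq_minus :: "'p::prime_card padic_seq \<Rightarrow> 'p padic_seq"
  is "\<lambda>X n. - X n"
  by (rule padic_cauchy_minus [OF prime_card])

lift_definition seq_mult :: "'p::prime_card padic_seq \<Rightarrow> 'p padic_seq \<Rightarrow> 'p padic_seq"
  is "\<lambda>X Y n. X n * Y n"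
  by (rule padic_cauchy_mult [OF prime_card])

lift_definition seq_inverse :: "'p::prime_card padic_seq \<Rightarrow> 'p padic_seq"
  is "\<lambda>X. if padic_null CARD('p) X then (\<lambda>n. 0) else (\<lambda>n. inverse (X n))"
  by (simp add: padic_cauchy_inverse prime_card)

lift_definition seq_abs :: "'p::prime_card padic_seq \<Rightarrow> real"
  is "\<lambda>X. lim (\<lambda>n. rat_padic_abs CARD('p) (X n))" .

quotient_type (overloaded) 'p padic = "'p::prime_card padic_seq" / padic_seq_rel
  morphisms rep_padic padic_of_seq
proof (rule equivpI)
  show "reflp padic_seq_rel"
    by (rule reflpI, transfer) (simp add: padic_rel_def)
  show "symp padic_seq_rel"
    by (rule sympI, transfer) (rule padic_rel_sym [OF prime_card])
  show "transp padic_seq_rel"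
    by (rule transpI, transfer) (rule padic_rel_trans [OF prime_card])
qed

instantiation padic :: (prime_card) field
begin

lift_definition zero_padic :: "'a padic" is "seq_const 0" .

lift_definition one_padic :: "'a padic" is "seq_const 1" .

lift_definition plus_padic :: "'a padic \<Rightarrow> 'a padic \<Rightarrow> 'a padic" is seq_add
  by transfer (rule padic_rel_add [OF prime_card])

lift_definition uminus_padic :: "'a padic \<Rightarrow> 'a padic" is seq_minus
  by transfer (rule padic_rel_minus [OF prime_card])

lift_definition times_padic :: "'a padic \<Rightarrow> 'a padic \<Rightarrow> 'a padic" is seq_mult
  by transfer (rule padic_rel_mult [OF prime_card])

lift_definition inverse_padic :: "'a padic \<Rightarrow> 'a padic" is seq_inverse
proof transfer
  fix X Y :: "nat \<Rightarrow> rat"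
  assume "padic_rel CARD('a) X Y"
  then show "padic_rel CARD('a)
      (if padic_null CARD('a) X then \<lambda>n. 0 else (\<lambda>n. inverse (X n)))
      (if padic_null CARD('a) Y then \<lambda>n. 0 else (\<lambda>n. inverse (Y n)))"
    using padic_rel_null_iff [OF prime_card] padic_rel_inverse [OF prime_card, of X Y]
    by (auto simp: padic_rel_def)
qed

definition minus_padic :: "'a padic \<Rightarrow> 'a padic \<Rightarrow> 'a padic" where
  "minus_padic x y = x + - y"

definition divide_padic :: "'a padic \<Rightarrow> 'a padic \<Rightarrow> 'a padic" where
  "divide_padic x y = x * inverse y"

instance
proof
  fix a b c :: "'a padic"
  note pc = padic_cauchy_add [OF prime_card] padic_cauchy_mult [OF prime_card]
    padic_cauchy_minus [OF prime_card]
  show "a + b = b + a"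
    by (transfer, transfer) (simp add: padic_rel_def ac_simps pc)
  show "(a + b) + c = a + (b + c)"
    by (transfer, transfer) (simp add: padic_rel_def ac_simps pc)
  show "0 + a = a"
    by (transfer, transfer) (simp add: padic_rel_def)
  show "- a + a = 0"
    by (transfer, transfer) (simp add: padic_rel_def)
  show "a - b = a + - b"
    by (rule minus_padic_def)
  show "(a * b) * c = a * (b * c)"
    by (transfer, transfer) (simp add: padic_rel_def ac_simps pc)
  show "a * b = b * a"
    by (transfer, transfer) (simp add: padic_rel_def ac_simps pc)
  show "1 * a = a"
    by (transfer, transfer) (simp add: padic_rel_def)
  show "(a + b) * c = a * c + b * c"
    by (transfer, transfer) (simp add: padic_rel_def distrib_right pc)
  show "(0::'a padic) \<noteq> 1"
    by (transfer, transfer)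
       (simp add: padic_rel_def padic_null_def rat_padic_abs_1 [OF prime_card]
          rat_padic_abs_minus [OF prime_card] LIMSEQ_const_iff)
  show "a \<noteq> 0 \<Longrightarrow> inverse a * a = 1"
    by (transfer, transfer)
       (auto simp: padic_rel_def pc padic_cauchy_inverse [OF prime_card]
          padic_null_inverse_mult [OF prime_card])
  show "a div b = a * inverse b"
    by (rule divide_padic_def)
  show "inverse (0::'a padic) = 0"
    by (transfer, transfer) (simp add: padic_rel_def)
qed

end

lemma padic_const_of_nat: "padic_of_seq (seq_const (of_nat n)) = (of_nat n :: 'p::prime_card padic)"
proof (induction n)
  case 0
  show ?case by (simp add: zero_padic_def)
next
  case (Suc n)
  have "seq_const (of_nat (Suc n)) = (seq_add (seq_const 1) (seq_const (of_nat n)) :: 'p padic_seq)"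
    by transfer simp
  then show ?case
    by (simp add: Suc flip: plus_padic.abs_eq one_padic.abs_eq)
qed

lemma padic_const_minus:
  "padic_of_seq (seq_const (- q)) = - (padic_of_seq (seq_const q) :: 'p::prime_card padic)"
proof -
  have "seq_const (- q) = (seq_minus (seq_const q) :: 'p padic_seq)"
    by transfer simp
  then show ?thesis by (simp add: uminus_padic.abs_eq)
qed

lemma padic_const_mult:
  "padic_of_seq (seq_const (q * r))
     = (padic_of_seq (seq_const q) * padic_of_seq (seq_const r) :: 'p::prime_card padic)"
proof -
  have "seq_const (q * r) = (seq_mult (seq_const q) (seq_const r) :: 'p padic_seq)"
    by transfer simp
  then show ?thesis by (simp add: times_padic.abs_eq)
qed

lemma padic_const_of_int: "padic_of_seq (seq_const (of_int k)) = (of_int k :: 'p::prime_card padic)"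
  by (cases k) (simp_all add: padic_const_of_nat padic_const_minus del: of_nat_Suc)

instance padic :: (prime_card) field_char_0
proof
  show "inj (of_nat :: nat \<Rightarrow> 'a padic)"
  proof (rule injI)
    fix m n
    assume "(of_nat m :: 'a padic) = of_nat n"
    then have "padic_seq_rel (seq_const (of_nat m)) (seq_const (of_nat n) :: 'a padic_seq)"
      by (simp add: padic.abs_eq_iff flip: padic_const_of_nat)
    then have "padic_rel CARD('a) (\<lambda>_. of_nat m) (\<lambda>_. of_nat n)"
      by transfer
    then show "m = n"
      by (simp add: padic_rel_def padic_null_def LIMSEQ_const_iff rat_padic_abs_eq_0 [OF prime_card])
  qed
qed

lemma padic_const_of_rat: "padic_of_seq (seq_const q) = (of_rat q :: 'p::prime_card padic)"
proof -
  obtain a b :: int where ab: "b \<noteq> 0" "q = of_int a / of_int b"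
    using rat_as_fract [of "CARD('p)" q] prime_card by metis
  have "padic_of_seq (seq_const q) * (of_int b :: 'p padic) = of_int a"
    using ab by (simp flip: padic_const_of_int padic_const_mult)
  then have "padic_of_seq (seq_const q) = (of_int a / of_int b :: 'p padic)"
    using ab(1) by (simp only: eq_divide_eq of_int_eq_0_iff not_False_eq_True if_True)
  with ab show ?thesis
    by (simp add: of_rat_divide)
qed


subsection \<open>The p-adic absolute value and the induced metric\<close>

text \<open>
  A separate constant, since the library reserves \<^term>\<open>norm\<close> for norms of real vector spaces.
\<close>

lift_definition padic_abs :: "'p::prime_card padic \<Rightarrow> real" is seq_abs
  by transfer (rule padic_rel_lim [OF prime_card])

lemma seq_abs_LIMSEQ:
  fixes X :: "'p::prime_card padic_seq"
  shows "(\<lambda>n. rat_padic_abs CARD('p) (seq_of X n)) \<longlonglongrightarrow> seq_abs X"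
proof -
  have "convergent (\<lambda>n. rat_padic_abs CARD('p) (seq_of X n))"
    by transfer (rule padic_cauchy_convergent [OF prime_card])
  then show ?thesis
    by (simp add: seq_abs.rep_eq convergent_LIMSEQ_iff)
qed

lemma padic_abs_of_rat [simp]:
  "padic_abs (of_rat q :: 'p::prime_card padic) = rat_padic_abs CARD('p) q"
proof -
  have "seq_abs (seq_const q :: 'p padic_seq) = rat_padic_abs CARD('p) q"
    by transfer (simp add: limI)
  then show ?thesis
    by (simp add: padic_abs.abs_eq flip: padic_const_of_rat)
qed

lemma padic_abs_ge_0 [simp]: "padic_abs (x :: 'p::prime_card padic) \<ge> 0"
proof transfer
  fix X :: "'p padic_seq"
  show "seq_abs X \<ge> 0"
    using seq_abs_LIMSEQ [of X]
    by (rule LIMSEQ_le_const) (simp add: rat_padic_abs_ge_0 [OF prime_card])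
qed

lemma padic_abs_eq_0 [simp]: "padic_abs (x :: 'p::prime_card padic) = 0 \<longleftrightarrow> x = 0"
proof transfer
  fix X :: "'p padic_seq"
  have "seq_abs X = 0 \<longleftrightarrow> padic_null CARD('p) (seq_of X)"
    unfolding padic_null_def using seq_abs_LIMSEQ [of X] LIMSEQ_unique by metis
  also have "\<dots> \<longleftrightarrow> padic_seq_rel X (seq_const 0)"
    by transfer (simp add: padic_rel_def)
  finally show "seq_abs X = 0 \<longleftrightarrow> padic_seq_rel X (seq_const 0)" .
qed

lemma padic_abs_mult: "padic_abs (x * y :: 'p::prime_card padic) = padic_abs x * padic_abs y"
proof transfer
  fix X Y :: "'p padic_seq"
  have "(\<lambda>n. rat_padic_abs CARD('p) (seq_of (seq_mult X Y) n)) \<longlonglongrightarrow> seq_abs X * seq_abs Y"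
    using tendsto_mult [OF seq_abs_LIMSEQ [of X] seq_abs_LIMSEQ [of Y]]
    by (simp add: seq_mult.rep_eq rat_padic_abs_mult [OF prime_card])
  then show "seq_abs (seq_mult X Y) = seq_abs X * seq_abs Y"
    using seq_abs_LIMSEQ LIMSEQ_unique by blast
qed

lemma padic_abs_minus [simp]: "padic_abs (- x :: 'p::prime_card padic) = padic_abs x"
proof transfer
  fix X :: "'p padic_seq"
  show "seq_abs (seq_minus X) = seq_abs X"
    by transfer (simp add: rat_padic_abs_minus [OF prime_card])
qed

lemma padic_abs_ultra: "padic_abs (x + y :: 'p::prime_card padic) \<le> max (padic_abs x) (padic_abs y)"
proof transfer
  fix X Y :: "'p padic_seq"
  show "seq_abs (seq_add X Y) \<le> max (seq_abs X) (seq_abs Y)"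
    by (rule LIMSEQ_le [OF seq_abs_LIMSEQ tendsto_max [OF seq_abs_LIMSEQ seq_abs_LIMSEQ]])
       (simp add: seq_add.rep_eq rat_padic_abs_ultra [OF prime_card])
qed

instantiation padic :: (prime_card) metric_space
begin

definition dist_padic :: "'a padic \<Rightarrow> 'a padic \<Rightarrow> real" where
  "dist_padic x y = padic_abs (x - y)"

definition uniformity_padic :: "('a padic \<times> 'a padic) filter" where
  "uniformity_padic = (INF e\<in>{0<..}. principal {(x, y). dist x y < e})"

definition open_padic :: "'a padic set \<Rightarrow> bool" where
  "open_padic U \<longleftrightarrow> (\<forall>x\<in>U. \<forall>\<^sub>F (x', y) in uniformity. x' = x \<longrightarrow> y \<in> U)"

instance
proof
  fix x y z :: "'a padic" and U :: "'a padic set"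
  show "uniformity = (INF e\<in>{0<..}. principal {(x :: 'a padic, y). dist x y < e})"
    by (rule uniformity_padic_def)
  show "open U \<longleftrightarrow> (\<forall>x\<in>U. \<forall>\<^sub>F (x', y) in uniformity. x' = x \<longrightarrow> y \<in> U)"
    by (rule open_padic_def)
  show "dist x y = 0 \<longleftrightarrow> x = y"
    by (simp add: dist_padic_def)
  show "dist x y \<le> dist x z + dist y z"
  proof -
    have "x - y = (x - z) + (z - y)" by simp
    then have "padic_abs (x - y) \<le> max (padic_abs (x - z)) (padic_abs (z - y))"
      by (metis padic_abs_ultra)
    also have "padic_abs (z - y) = padic_abs (y - z)"
      by (metis minus_diff_eq padic_abs_minus)
    also have "max (padic_abs (x - z)) (padic_abs (y - z)) \<le> padic_abs (x - z) + padic_abs (y - z)"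
      by simp
    finally show ?thesis by (simp add: dist_padic_def)
  qed
qed

end

text \<open>
  The rationals are dense and the metric is complete, so this is indeed a completion.
\<close>

lemma padic_of_rat_LIMSEQ:
  fixes X :: "'p::prime_card padic_seq"
  shows "(\<lambda>n. of_rat (seq_of X n)) \<longlonglongrightarrow> padic_of_seq X"
proof (rule metric_LIMSEQ_I)
  fix e :: real
  assume e: "e > 0"
  have "padic_cauchy CARD('p) (seq_of X)"
    by transfer simp
  moreover have "e / 2 > 0" using e by simp
  ultimately obtain N where N: "\<forall>m\<ge>N. \<forall>n\<ge>N. rat_padic_abs CARD('p) (seq_of X m - seq_of X n) < e / 2"
    unfolding padic_cauchy_def by blast
  have "dist (of_rat (seq_of X k)) (padic_of_seq X) < e" if "k \<ge> N" for k
  proof -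
    let ?Y = "seq_add X (seq_minus (seq_const (seq_of X k)))"
    have "padic_of_seq X - of_rat (seq_of X k) = padic_of_seq ?Y"
      by (simp add: minus_padic_def plus_padic.abs_eq uminus_padic.abs_eq
          flip: padic_const_of_rat)
    then have "dist (padic_of_seq X) (of_rat (seq_of X k)) = seq_abs ?Y"
      by (simp add: dist_padic_def padic_abs.abs_eq)
    also have "\<dots> \<le> e / 2"
      by (rule LIMSEQ_le_const2 [OF seq_abs_LIMSEQ])
         (use N that in \<open>auto simp: seq_add.rep_eq seq_minus.rep_eq seq_const.rep_eq
            intro!: exI [of _ N] less_imp_le\<close>)
    also have "\<dots> < e" using e by simp
    finally show ?thesis by (simp add: dist_commute)
  qed
  then show "\<exists>N. \<forall>n\<ge>N. dist (of_rat (seq_of X n)) (padic_of_seq X) < e"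
    by blast
qed

lemma padic_of_rat_dense:
  fixes x :: "'p::prime_card padic"
  assumes "e > 0"
  obtains q where "dist x (of_rat q) < e"
proof -
  obtain X where "x = padic_of_seq X"
    by (metis Quotient_padic Quotient_abs_rep)
  moreover obtain N where "dist (of_rat (seq_of X N)) (padic_of_seq X) < e"
    using metric_LIMSEQ_D [OF padic_of_rat_LIMSEQ assms, of X] by blast
  ultimately show ?thesis
    using that [of "seq_of X N"] by (simp add: dist_commute)
qed

instance padic :: (prime_card) complete_space
proof
  fix x :: "nat \<Rightarrow> 'a padic"
  assume x: "Cauchy x"
  have "\<exists>q. dist (x n) (of_rat q) < inverse (Suc n)" for n
    using padic_of_rat_dense [of "inverse (Suc n)" "x n"] by auto
  then obtain q where q: "\<And>n. dist (x n) (of_rat (q n)) < inverse (Suc n)"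
    by metis
  have 0: "(\<lambda>n. dist (x n) (of_rat (q n))) \<longlonglongrightarrow> 0"
    by (rule tendsto_sandwich [OF _ _ tendsto_const LIMSEQ_inverse_real_of_nat])
       (use less_imp_le [OF q] in \<open>auto intro!: always_eventually\<close>)
  have "padic_cauchy CARD('a) q"
    unfolding padic_cauchy_def
  proof (intro allI impI)
    fix e :: real
    assume "e > 0"
    then have e: "e / 3 > 0" by simp
    from metric_CauchyD [OF x e] obtain M where
      M: "\<And>m n. m \<ge> M \<Longrightarrow> n \<ge> M \<Longrightarrow> dist (x m) (x n) < e / 3" by blast
    from order_tendstoD(2) [OF 0 e] obtain N where
      N: "\<And>n. n \<ge> N \<Longrightarrow> dist (x n) (of_rat (q n)) < e / 3"
      by (auto simp: eventually_sequentially)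
    have "rat_padic_abs CARD('a) (q m - q n) < e" if "m \<ge> max M N" "n \<ge> max M N" for m n
    proof -
      have "rat_padic_abs CARD('a) (q m - q n) = dist (of_rat (q m) :: 'a padic) (of_rat (q n))"
        by (simp add: dist_padic_def flip: of_rat_diff padic_abs_of_rat)
      also have "\<dots> \<le> dist (x m) (of_rat (q m)) + dist (x m) (x n) + dist (x n) (of_rat (q n))"
        using dist_triangle3 [of "of_rat (q m)" "of_rat (q n)" "x m"]
          dist_triangle [of "x m" "of_rat (q n)" "x n"] by linarith
      also have "\<dots> < e"
        using M [of m n] N [of m] N [of n] that by simp
      finally show ?thesis .
    qed
    then show "\<exists>N. \<forall>m\<ge>N. \<forall>n\<ge>N. rat_padic_abs CARD('a) (q m - q n) < e"
      by blast
  qed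
  then have "seq_of (Abs_padic_seq q :: 'a padic_seq) = q"
    by (simp add: Abs_padic_seq_inverse)
  with padic_of_rat_LIMSEQ [of "Abs_padic_seq q :: 'a padic_seq"]
  have lim: "(\<lambda>n. of_rat (q n)) \<longlonglongrightarrow> (padic_of_seq (Abs_padic_seq q) :: 'a padic)"
    by simp
  let ?l = "padic_of_seq (Abs_padic_seq q) :: 'a padic"
  have sum: "(\<lambda>n. dist (x n) (of_rat (q n)) + dist (of_rat (q n)) ?l) \<longlonglongrightarrow> 0"
    using tendsto_add [OF 0 lim [unfolded tendsto_dist_iff [of _ ?l]]] by simp
  have "(\<lambda>n. dist (x n) ?l) \<longlonglongrightarrow> 0"
    by (rule tendsto_sandwich [OF _ _ tendsto_const sum])
       (auto intro!: always_eventually dist_triangle)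
  then show "convergent x"
    unfolding convergent_def tendsto_dist_iff [of x] by blast
qed

end

theory Submission
  imports Defs
begin

text \<open>
  Write d(j,n) for the error of the j-th partial quotient at step n, and b(n) for the numerator
  a(m+1,n).  All errors have absolute value below 1, and the recursion for the complete quotients
  says that the vector (\<alpha>(1,n+1), \<dots>, \<alpha>(m,n+1), b(n+1)) is \<alpha>(1,n+1) times
  (1, d(1,n), \<dots>, d(m,n)).  Hence the first partial quotient strictly dominates all others and has
  absolute value at least 1, so the denominators are nonzero, with nondecreasing absolute value
  at least 1.  The same proportionality shows that the remainders
  V(n) = A(i,n) - \<alpha>(i,0) A(m+1,n) satisfy V(n) = - (d(1,n) V(n-1) + \<dots> + d(m,n) V(n-m)).
  As the value group is discrete, the errors have absolute value at most 1/p, so V tends to 0,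
  and a fortiori so does V(n) / A(m+1,n).
\<close>

section \<open>Ultrametric estimates\<close>

lemma padic_abs_0 [simp]: "padic_abs (0 :: 'p::prime_card padic) = 0"
  by simp

text \<open>By density some nonzero rational is closer to \<open>x\<close> than the size of
  \<open>x\<close>. The ultrametric inequality gives it the same absolute value, which is a power of
  p by definition.\<close>

lemma padic_abs_power_int:
  fixes x :: "'p::prime_card padic"
  assumes "x \<noteq> 0"
  obtains k :: int where "padic_abs x = real CARD('p) powi k"
proof -
  have "padic_abs x > 0"
    using assms padic_abs_ge_0 [of x] by (simp add: order.strict_iff_order)
  then obtain q where q: "dist x (of_rat q) < padic_abs x"
    using padic_of_rat_dense by blast
  have "padic_abs (of_rat q :: 'p padic) = padic_abs x"
    using q padic_abs_ultra [of "x - of_rat q" "of_rat q"]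
      padic_abs_ultra [of "of_rat q - x" x] padic_abs_minus [of "x - of_rat q"]
    by (simp add: dist_padic_def max_def split: if_splits)
  moreover have "q \<noteq> 0"
    using calculation \<open>padic_abs x > 0\<close> by auto
  then have "\<exists>k. rat_padic_abs CARD('p) q = real CARD('p) powi k"
    by (auto simp: rat_padic_abs_def)
  ultimately show ?thesis
    using that by auto
qed

text \<open>Discreteness of the value group turns a strict bound into a uniform gap, so one
  contraction factor serves all errors.\<close>

lemma padic_abs_less_1_imp_le:
  fixes x :: "'p::prime_card padic"
  assumes "padic_abs x < 1"
  shows "padic_abs x \<le> 1 / real CARD('p)"
proof (cases "x = 0")
  case False
  have p: "real CARD('p) > 1"
    using prime_gt_1_nat [OF prime_card [where 'a = 'p]] by simp
  from False obtain k where k: "padic_abs x = real CARD('p) powi k"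
    by (rule padic_abs_power_int)
  have "k < 0"
    using assms p one_le_power_int [of "real CARD('p)" k] by (fastforce simp: k)
  then have "padic_abs x \<le> real CARD('p) powi (- 1)"
    using p unfolding k by (intro power_int_increasing) auto
  also have "real CARD('p) powi (- 1) = 1 / real CARD('p)"
    by (simp add: power_int_minus divide_inverse)
  finally show ?thesis .
qed simp

lemma padic_abs_sum_le_term:
  fixes f :: "'a \<Rightarrow> 'p::prime_card padic"
  assumes "finite S" "S \<noteq> {}"
  shows "\<exists>x\<in>S. padic_abs (sum f S) \<le> padic_abs (f x)"
  using assms
proof (induction rule: finite_ne_induct)
  case (insert x S)
  with padic_abs_ultra [of "f x" "sum f S"] show ?case
    by (fastforce simp: max_def split: if_splits)
qed simp

text \<open>Writing \<open>x\<close> as \<open>(x + y) + (- y)\<close> and applying the ultrametric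
  inequality once more shows that the sum cannot be smaller than \<open>x\<close>.\<close>

lemma padic_abs_add_eq:
  fixes x y :: "'p::prime_card padic"
  assumes "padic_abs y < padic_abs x"
  shows "padic_abs (x + y) = padic_abs x"
  using assms padic_abs_ultra [of x y] padic_abs_ultra [of "x + y" "- y"]
  by (auto simp: max_def split: if_splits)


section \<open>Linear recurrences\<close>

text \<open>The first coefficient strictly beats the others and multiplies the largest value so far,
  so the first term alone determines the absolute value of the sum. Monotonicity is carried along to
  keep the latest value largest.\<close>

lemma dominant_recurrence_mono:
  fixes X :: "nat \<Rightarrow> 'p::prime_card padic"
  assumes m: "m \<ge> 1"
    and rec: "\<And>n. X (Suc n + m) = (\<Sum>j = 1..m + 1. c j n * X (Suc n + m - j))"
    and c1: "\<And>n. padic_abs (c 1 n) \<ge> 1"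
    and cj: "\<And>j n. j \<in> {2..m + 1} \<Longrightarrow> padic_abs (c j n) < padic_abs (c 1 n)"
    and Xm: "padic_abs (X m) \<ge> 1"
    and X_init: "\<And>k. k < m \<Longrightarrow> padic_abs (X k) \<le> padic_abs (X m)"
  shows "1 \<le> padic_abs (X (n + m)) \<and> (\<forall>k\<le>n + m. padic_abs (X k) \<le> padic_abs (X (n + m)))"
proof (induction n)
  case 0
  then show ?case using Xm X_init by (auto simp: le_less)
next
  case (Suc n)
  let ?f = "\<lambda>j. c j n * X (Suc n + m - j)"
  have split: "X (Suc n + m) = c 1 n * X (n + m) + sum ?f {2..m + 1}"
    unfolding rec using sum.atLeast_Suc_atMost [of 1 "m + 1" ?f]
    by (simp add: numeral_2_eq_2 del: sum.cl_ivl_Suc)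
  have "{2..m + 1} \<noteq> {}" using m by simp
  then obtain j where j: "j \<in> {2..m + 1}" "padic_abs (sum ?f {2..m + 1}) \<le> padic_abs (?f j)"
    using padic_abs_sum_le_term [of "{2..m + 1}" ?f] by blast
  note j(2)
  also have "padic_abs (?f j) \<le> padic_abs (c j n) * padic_abs (X (n + m))"
    using Suc j(1) by (auto simp: padic_abs_mult intro!: mult_left_mono)
  \<comment> \<open>Strictness needs a nonzero \<open>X (n + m)\<close>, which the lower bound 1 in
    the induction hypothesis supplies.\<close>
  also have "\<dots> < padic_abs (c 1 n) * padic_abs (X (n + m))"
    using Suc cj [OF j(1)] by (intro mult_strict_right_mono) auto
  finally have "padic_abs (X (Suc n + m)) = padic_abs (c 1 n) * padic_abs (X (n + m))"
    unfolding split by (simp add: padic_abs_add_eq padic_abs_mult)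
  moreover have "1 * padic_abs (X (n + m)) \<le> padic_abs (c 1 n) * padic_abs (X (n + m))"
    using c1 by (intro mult_right_mono) auto
  ultimately have "padic_abs (X (n + m)) \<le> padic_abs (X (Suc n + m))" by simp
  with Suc show ?case by (force simp: le_Suc_eq)
qed

text \<open>Each value is at most \<open>r\<close> times one of the \<open>m\<close> preceding ones,
  so every block of \<open>m\<close> indices gains a factor \<open>r\<close>. The sum of the first
  \<open>m\<close> values bounds the initial block.\<close>

lemma contracting_recurrence_tendsto_0:
  fixes W :: "nat \<Rightarrow> real"
  assumes m: "m \<ge> 1" and r: "0 \<le> r" "r < 1"
    and W_nonneg: "\<And>n. W n \<ge> 0"
    and W_rec: "\<And>n. \<exists>k\<in>{n..<n + m}. W (n + m) \<le> r * W k"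
  shows "W \<longlonglongrightarrow> 0"
proof -
  define C where "C = sum W {..<m}"
  have C: "C \<ge> 0" using W_nonneg by (simp add: C_def sum_nonneg)
  have bound: "W k \<le> C * r ^ (k div m)" for k
  proof (induction k rule: less_induct)
    case (less k)
    show ?case
    proof (cases "k < m")
      case True
      then show ?thesis
        using W_nonneg by (auto simp: C_def intro!: member_le_sum)
    next
      case False
      define n where "n = k - m"
      with False have k: "k = n + m" by simp
      obtain l where l: "l \<in> {n..<n + m}" "W k \<le> r * W l"
        using W_rec [of n] k by blast
      have "W l \<le> C * r ^ (l div m)"
        using less l k by simp
      \<comment> \<open>As \<open>k = n + m\<close>, the exponent \<open>n div m\<close> is one less
        than \<open>k div m\<close>; the factor \<open>r\<close> from the recurrence makes up for
        it.\<close>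
      also have "\<dots> \<le> C * r ^ (n div m)"
        using C r l by (intro mult_left_mono power_decreasing div_le_mono) auto
      finally have "r * W l \<le> r * (C * r ^ (n div m))"
        using r by (intro mult_left_mono) auto
      with l m show ?thesis by (simp add: k mult_ac)
    qed
  qed
  have "filterlim (\<lambda>k. k div m) sequentially sequentially"
    using m by (intro filterlim_at_top_div_const_nat) auto
  with r have "(\<lambda>k. r ^ (k div m)) \<longlonglongrightarrow> 0"
    by (intro filterlim_compose [OF LIMSEQ_power_zero]) auto
  then have lim: "(\<lambda>k. C * r ^ (k div m)) \<longlonglongrightarrow> 0"
    by (rule tendsto_mult_right_zero)
  show ?thesis
    by (rule tendsto_sandwich [OF _ _ tendsto_const lim])
       (auto simp: W_nonneg bound intro!: always_eventually)
qed

text \<open>Adding the sum with weights \<open>d\<close> to the recurrence with weights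
  \<open>c\<close> leaves the weights \<open>c + d\<close>, which are \<open>t n\<close> times
  \<open>(1, d 1 n, ..., d m n)\<close>. Hence the total is \<open>t n\<close> times the claim at
  the previous index, which is zero.\<close>

lemma remainder_recurrence:
  fixes V :: "nat \<Rightarrow> 'a::comm_ring_1" and c d :: "nat \<Rightarrow> nat \<Rightarrow> 'a"
  assumes rec: "\<And>n. V (Suc n + m) = (\<Sum>j = 1..m + 1. c j (Suc n) * V (Suc n + m - j))"
    and init: "V m = - (\<Sum>j = 1..m. d j 0 * V (m - j))"
    and c_1: "\<And>n. c 1 (Suc n) + d 1 (Suc n) = t n"
    and c_Suc: "\<And>j n. j \<in> {1..m} \<Longrightarrow> c (Suc j) (Suc n) + d (Suc j) (Suc n) = t n * d j n"
    and d_top: "\<And>n. d (m + 1) n = 0"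
  shows "V (n + m) = - (\<Sum>j = 1..m. d j n * V (n + m - j))"
proof (induction n)
  case 0
  then show ?case using init by simp
next
  case (Suc n)
  let ?V = "\<lambda>j. V (Suc n + m - j)"
  have "(\<Sum>j = 1..m + 1. (c j (Suc n) + d j (Suc n)) * ?V j)
      = t n * V (n + m) + (\<Sum>j = 1..m. t n * d j n * V (n + m - j))"
  proof -
    have "(\<Sum>j = 1..m + 1. (c j (Suc n) + d j (Suc n)) * ?V j)
        = (c 1 (Suc n) + d 1 (Suc n)) * ?V 1
          + (\<Sum>j = Suc 1..Suc m. (c j (Suc n) + d j (Suc n)) * ?V j)"
      by (subst sum.atLeast_Suc_atMost) auto
    also have "(\<Sum>j = Suc 1..Suc m. (c j (Suc n) + d j (Suc n)) * ?V j)
        = (\<Sum>j = 1..m. t n * d j n * V (n + m - j))"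
      unfolding sum.shift_bounds_cl_Suc_ivl by (intro sum.cong refl) (simp add: c_Suc)
    finally show ?thesis by (simp only: c_1) simp
  qed
  also have "\<dots> = t n * (V (n + m) + (\<Sum>j = 1..m. d j n * V (n + m - j)))"
    by (simp add: distrib_left sum_distrib_left mult.assoc)
  also have "\<dots> = 0"
    by (simp add: Suc)
  finally have "V (Suc n + m) + (\<Sum>j = 1..m + 1. d j (Suc n) * ?V j) = 0"
    by (simp only: rec distrib_right sum.distrib)
  then have "V (Suc n + m) + (\<Sum>j = 1..m. d j (Suc n) * ?V j) = 0"
    using d_top by simp
  then show ?case by (simp only: eq_neg_iff_add_eq_0)
qed


section \<open>Convergence\<close>

theorem theorem3p4:
  fixes m :: nat
    and s s' :: "nat \<Rightarrow> 'p::prime_card padic \<Rightarrow> rat"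
    and a Q :: "nat \<Rightarrow> nat \<Rightarrow> rat"
    and \<alpha> :: "nat \<Rightarrow> nat \<Rightarrow> 'p padic"
    and A :: "nat \<Rightarrow> int \<Rightarrow> rat"
  assumes m: "m \<ge> 1"
    and a_top_nonzero: "\<And>n. a (m + 1) n \<noteq> 0"
    and a_top_0: "a (m + 1) 0 = 1"
    and s_0: "\<And>i. i \<in> {1..m - 1} \<Longrightarrow> s i 0 = 0"
    and s'_0: "\<And>n. s' n 0 = 0"
    and s_approx: "\<And>i \<gamma>. i \<in> {1..m - 1} \<Longrightarrow> \<gamma> \<noteq> 0 \<Longrightarrow>
          padic_abs (\<gamma> - of_rat (s i \<gamma>)) < min (padic_abs \<gamma>) 1"
    and s'_approx: "\<And>n \<gamma>. \<gamma> \<noteq> 0 \<Longrightarrow>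
          padic_abs (\<gamma> - of_rat (s' n \<gamma>)) < min (padic_abs \<gamma>) 1"
    and s'_top: "\<And>n \<gamma>. \<gamma> \<noteq> 0 \<Longrightarrow>
          padic_abs (\<gamma> - of_rat (s' n \<gamma>)) \<le> padic_abs (of_rat (a (m + 1) (n + 1)) :: 'p padic)"
    and a_partial: "\<And>i n. i \<in> {1..m - 1} \<Longrightarrow> a i n = s i (\<alpha> i n)"
    and a_partial_m: "\<And>n. a m n = s' n (\<alpha> m n)"
    and no_termination: "\<And>n. \<alpha> m n \<noteq> of_rat (a m n)"
    and \<alpha>_1: "\<And>n. \<alpha> 1 (n + 1) = of_rat (a (m + 1) (n + 1)) / (\<alpha> m n - of_rat (a m n))"
    and \<alpha>_i: "\<And>i n. i \<in> {2..m} \<Longrightarrow>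
          \<alpha> i (n + 1) = of_rat (a (m + 1) (n + 1)) *
            ((\<alpha> (i - 1) n - of_rat (a (i - 1) n)) / (\<alpha> m n - of_rat (a m n)))"
    and A_neg: "\<And>i j. i \<in> {1..m + 1} \<Longrightarrow> j \<in> {1..m} \<Longrightarrow>
          A i (- int j) = (if i = j then 1 else 0)"
    and A_0: "\<And>i. i \<in> {1..m + 1} \<Longrightarrow> A i 0 = a i 0"
    and A_rec: "\<And>i n. i \<in> {1..m + 1} \<Longrightarrow> n \<ge> 1 \<Longrightarrow>
          A i (int n) = (\<Sum>j = 1..m + 1. a j n * A i (int n - int j))"
    and Q: "\<And>i n. i \<in> {1..m} \<Longrightarrow> Q i n = A i (int n) / A (m + 1) (int n)"
  shows "(\<forall>n. A (m + 1) (int n) \<noteq> 0) \<and>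
         (\<forall>i\<in>{1..m}. (\<lambda>n. of_rat (Q i n)) \<longlonglongrightarrow> \<alpha> i 0)"
proof -

  \<comment> \<open>Sizes of errors and partial quotients\<close>
  define b :: "nat \<Rightarrow> 'p padic" where "b = (\<lambda>n. of_rat (a (m + 1) n))"
  \<comment> \<open>The value 0 at index \<open>m + 1\<close> makes \<open>c + d\<close> equal to
    \<open>b\<close> there, so the proportionality covers that index too.\<close>
  define d where "d = (\<lambda>j n. if j \<in> {1..m} then \<alpha> j n - of_rat (a j n) else 0)"
  define c :: "nat \<Rightarrow> nat \<Rightarrow> 'p padic" where "c = (\<lambda>j n. of_rat (a j n))"
  define t where "t = (\<lambda>n. \<alpha> 1 (Suc n))"
  \<comment> \<open>A zero complete quotient would be approximated by 0 exactly, which is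
    termination.\<close>
  have \<alpha>_m_nz: "\<alpha> m n \<noteq> 0" for n
    using no_termination [of n] s'_0 by (auto simp: a_partial_m)
  \<comment> \<open>For \<open>j < m\<close> a complete quotient may vanish; the approximation
    bounds say nothing then, but its partial quotient and error are both 0.\<close>
  have d_less: "padic_abs (d j n) < 1 \<and> (\<alpha> j n \<noteq> 0 \<longrightarrow> padic_abs (d j n) < padic_abs (\<alpha> j n))
      \<and> (\<alpha> j n = 0 \<longrightarrow> c j n = 0)" if j: "j \<in> {1..m}" for j n
  proof (cases "j = m")
    case True
    then show ?thesis
      using s'_approx [OF \<alpha>_m_nz, of n n] \<alpha>_m_nz j by (simp add: d_def a_partial_m)
  next
    case False
    with j have j': "j \<in> {1..m - 1}" by auto
    then show ?thesis
      using s_approx [OF j', of "\<alpha> j n"] s_0 [OF j'] j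
      by (cases "\<alpha> j n = 0") (simp_all add: d_def c_def a_partial)
  qed
  have c_abs: "padic_abs (c j n) = padic_abs (\<alpha> j n)" if "j \<in> {1..m}" for j n
    using padic_abs_add_eq [of "- d j n" "\<alpha> j n"] d_less [OF that, of n] that
    by (cases "\<alpha> j n = 0") (auto simp: d_def c_def)
  have dm: "d m n = \<alpha> m n - of_rat (a m n)" "d m n \<noteq> 0" for n
    using no_termination [of n] m by (auto simp: d_def)
  have t_dm: "t n * d m n = b (Suc n)" for n
    using \<alpha>_1 [of n] dm [of n] by (simp add: t_def b_def)
  have \<alpha>_Suc: "\<alpha> (Suc j) (Suc n) = t n * d j n" if "j \<in> {1..<m}" for j n
    using \<alpha>_i [of "Suc j" n] \<alpha>_1 [of n] that by (simp add: t_def d_def)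
  \<comment> \<open>The bound \<open>s'_top\<close> reads |d(m,n)| \<le> |b(n+1)| = |t(n)| |d(m,n)|;
    cancel the nonzero error.\<close>
  have t_ge_1: "padic_abs (t n) \<ge> 1" for n
  proof -
    have "padic_abs (d m n) \<le> padic_abs (b (Suc n))"
      using s'_top [OF \<alpha>_m_nz, of n n] by (simp add: dm a_partial_m b_def)
    then have "1 * padic_abs (d m n) \<le> padic_abs (t n) * padic_abs (d m n)"
      by (simp flip: padic_abs_mult t_dm)
    moreover have "padic_abs (d m n) > 0"
      using dm(2) by (simp add: order.strict_iff_order)
    ultimately show ?thesis by (simp only: mult_le_cancel_right_pos)
  qed
  have c_Suc: "c (Suc j) (Suc n) + d (Suc j) (Suc n) = t n * d j n" if "j \<in> {1..m}" for j n
    using that \<alpha>_Suc [of j n] t_dm [of n] by (cases "j = m") (auto simp: c_def d_def b_def)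
  have c_1: "c 1 (Suc n) + d 1 (Suc n) = t n" for n
    using m by (simp add: c_def d_def t_def)
  have c_1_abs: "padic_abs (c 1 (Suc n)) = padic_abs (t n)" for n
    using c_abs [of 1 "Suc n"] m by (simp add: t_def)
  \<comment> \<open>For \<open>j = Suc i\<close> the left side is |t(n)| |d(i,n)|, with error below
    1, while |c(1,n+1)| = |t(n)|.\<close>
  have c_less: "padic_abs (c j (Suc n)) < padic_abs (c 1 (Suc n))" if j: "j \<in> {2..m + 1}" for j n
  proof -
    from j obtain i where i: "j = Suc i" "i \<in> {1..m}" by (cases j) auto
    have "padic_abs (c j (Suc n)) = padic_abs (t n * d i n)"
      using i c_abs [of j "Suc n"] \<alpha>_Suc [of i n] t_dm [of n]
      by (cases "i = m") (auto simp: c_def b_def)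
    also have "\<dots> < padic_abs (t n) * 1"
      unfolding padic_abs_mult using d_less [OF i(2), of n] t_ge_1 [of n]
      by (intro mult_strict_left_mono) linarith+
    finally show ?thesis unfolding c_1_abs by simp
  qed

  \<comment> \<open>Shifting the index by \<open>m\<close> makes all indices natural numbers.\<close>
  define X :: "nat \<Rightarrow> nat \<Rightarrow> 'p padic" where "X = (\<lambda>i k. of_rat (A i (int k - int m)))"
  have X_neg: "X i (m - j) = (if i = j then 1 else 0)"
    if "i \<in> {1..m + 1}" "j \<in> {1..m}" for i j
    using A_neg [OF that] that by (simp add: X_def of_nat_diff)
  have X_init: "X i k = (if i = m - k then 1 else 0)" if "i \<in> {1..m + 1}" "k < m" for i k
    using X_neg [of i "m - k"] that by simp
  have X_m: "X i m = c i 0" if "i \<in> {1..m + 1}" for i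
    using A_0 [OF that] by (simp add: X_def c_def)
  have X_rec: "X i (Suc n + m) = (\<Sum>j = 1..m + 1. c j (Suc n) * X i (Suc n + m - j))"
    if i: "i \<in> {1..m + 1}" for i n
  proof -
    have "X i (Suc n + m) = of_rat (A i (int (Suc n)))"
      by (simp add: X_def)
    also have "\<dots> = (\<Sum>j = 1..m + 1. of_rat (a j (Suc n) * A i (int (Suc n) - int j)))"
      using A_rec [OF i, of "Suc n"] by (simp only: of_rat_sum)
    also have "\<dots> = (\<Sum>j = 1..m + 1. c j (Suc n) * X i (Suc n + m - j))"
      by (intro sum.cong refl) (auto simp: c_def X_def of_rat_mult of_nat_diff algebra_simps)
    finally show ?thesis .
  qed

  \<comment> \<open>Lower bound for the denominators\<close>
  have den: "1 \<le> padic_abs (X (m + 1) (n + m))" for n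
  proof -
    have "padic_abs (X (m + 1) m) = 1"
      using X_m [of "m + 1"] a_top_0 padic_abs_of_rat [of 1, where 'p = 'p]
        rat_padic_abs_1 [OF prime_card [where 'a = 'p]] by (simp add: c_def)
    moreover have "X (m + 1) k = 0" if "k < m" for k
      using X_init [of "m + 1" k] that by simp
    \<comment> \<open>The coefficients are taken at \<open>Suc n\<close> because the recurrence, and
      the dominance of \<open>c 1\<close>, start at step 1.\<close>
    ultimately show ?thesis
      using dominant_recurrence_mono [OF m, of "X (m + 1)" "\<lambda>j n. c j (Suc n)" n]
        X_rec [of "m + 1"] c_1_abs t_ge_1 c_less by simp
  qed
  have den_nz: "A (m + 1) (int n) \<noteq> 0" for n
    using den [of n] by (auto simp: X_def)

  \<comment> \<open>Decay of the remainders\<close>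
  have "(\<lambda>n. of_rat (Q i n)) \<longlonglongrightarrow> \<alpha> i 0" if i: "i \<in> {1..m}" for i
  proof -
    define V where "V = (\<lambda>k. X i k - \<alpha> i 0 * X (m + 1) k)"
    have i': "i \<in> {1..m + 1}" and m': "m + 1 \<in> {1..m + 1}" using i by simp_all
    have V_rec: "V (Suc n + m) = (\<Sum>j = 1..m + 1. c j (Suc n) * V (Suc n + m - j))" for n
      unfolding V_def X_rec [OF i'] X_rec [OF m']
      by (simp add: sum_distrib_left sum_subtractf algebra_simps del: sum.cl_ivl_Suc)
    have V_neg: "V (m - j) = (if i = j then 1 else 0)" if "j \<in> {1..m}" for j
      using X_neg [OF i' that] X_neg [of "m + 1" j] that by (simp add: V_def)
    have "V m = - d i 0"
      using X_m [OF i'] X_m [of "m + 1"] i a_top_0 by (simp add: V_def d_def c_def)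
    \<comment> \<open>The initial values \<open>V (m - j)\<close> are Kronecker deltas, so a single
      error already has the shape of the base case.\<close>
    also have "d i 0 = (\<Sum>j = 1..m. d j 0 * V (m - j))"
    proof -
      have "(\<Sum>j = 1..m. d j 0 * V (m - j)) = (\<Sum>j = 1..m. if i = j then d j 0 else 0)"
        by (intro sum.cong refl) (simp add: V_neg)
      then show ?thesis using i by simp
    qed
    finally have V_m: "V m = - (\<Sum>j = 1..m. d j 0 * V (m - j))" .
    have V_eq: "V (n + m) = - (\<Sum>j = 1..m. d j n * V (n + m - j))" for n
      using V_rec V_m c_1 c_Suc by (rule remainder_recurrence) (simp_all add: d_def)
    have "(\<lambda>k. padic_abs (V k)) \<longlonglongrightarrow> 0"
    proof (rule contracting_recurrence_tendsto_0 [OF m])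
      show "1 / real CARD('p) < 1"
        using prime_gt_1_nat [OF prime_card [where 'a = 'p]] by simp
      show "\<exists>k\<in>{n..<n + m}. padic_abs (V (n + m)) \<le> 1 / real CARD('p) * padic_abs (V k)" for n
      proof -
        obtain j where j: "j \<in> {1..m}"
          "padic_abs (\<Sum>j = 1..m. d j n * V (n + m - j)) \<le> padic_abs (d j n * V (n + m - j))"
          using padic_abs_sum_le_term [of "{1..m}" "\<lambda>j. d j n * V (n + m - j)"] m by auto
        have "padic_abs (V (n + m)) \<le> padic_abs (d j n) * padic_abs (V (n + m - j))"
          using j(2) by (simp add: V_eq [of n] padic_abs_mult)
        also have "\<dots> \<le> 1 / real CARD('p) * padic_abs (V (n + m - j))"
          using d_less [OF j(1), of n] by (intro mult_right_mono padic_abs_less_1_imp_le) auto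
        finally show ?thesis
          using j(1) by (intro bexI [of _ "n + m - j"]) auto
      qed
    qed auto
    then have lim: "(\<lambda>n. padic_abs (V (n + m))) \<longlonglongrightarrow> 0"
      by (rule LIMSEQ_ignore_initial_segment)
    have "dist (of_rat (Q i n)) (\<alpha> i 0) \<le> padic_abs (V (n + m))" for n
    proof -
      let ?B = "X (m + 1) (n + m)"
      have "(of_rat (Q i n) - \<alpha> i 0) * ?B = V (n + m)"
        using den_nz [of n] by (simp add: Q [OF i] V_def X_def of_rat_divide left_diff_distrib)
      then have "dist (of_rat (Q i n)) (\<alpha> i 0) * padic_abs ?B = padic_abs (V (n + m))"
        by (simp add: dist_padic_def flip: padic_abs_mult)
      \<comment> \<open>Denominators of size at least 1 can only shrink the remainder on
        division.\<close>
      moreover have "dist (of_rat (Q i n)) (\<alpha> i 0) * 1 \<le> dist (of_rat (Q i n)) (\<alpha> i 0) * padic_abs ?B"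
        using den by (intro mult_left_mono) auto
      ultimately show ?thesis by simp
    qed
    then have "(\<lambda>n. dist (of_rat (Q i n)) (\<alpha> i 0)) \<longlonglongrightarrow> 0"
      by (intro tendsto_sandwich [OF _ _ tendsto_const lim] always_eventually) auto
    then show ?thesis
      by (subst tendsto_dist_iff)
  qed
  with den_nz show ?thesis by blast
qed

end
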